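(* Let $\boldsymbol{\phi}\in\mathcal{K}_{++}$, $F\in\mathcal{H}^d$ and $A=\mathcal{A}(F)$. Suppose that $A$ is irreducible, $\rho(A)=1$, there exist $\boldsymbol{\lambda}\in\mathbb{R}^d_{++}$ and $\mathbf{u}\in\mathcal{S}^{\boldsymbol{\phi}}_{++}$ such that $F(\mathbf{u})=\boldsymbol{\lambda}\otimes\mathbf{u}$, and $F$ is differentiable at $\mathbf{u}$. Let $L\in\mathbb{R}^{|\mathcal{I}|\times|\mathcal{I}|}_+$ be defined by $$L_{(i,j_i),(k,l_k)}=\frac{1}{\lambda_i}\frac{\partial F_{i,j_i}(\mathbf{u})}{\partial x_{k,l_k}}\qquad\forall(i,j_i),(k,l_k)\in\mathcal{I}.$$ Then $\rho(L)=1$. Moreover, if $\dim(\ker(I-L))=1$, then $\mathbf{u}$ is the unique eigenvector of $F$ in $\mathcal{S}^{\boldsymbol{\phi}}_{++}$.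
   Context: $[n]=\{1,\ldots,n\}$; $\rho$ is the spectral radius and $I$ the identity matrix. Fix positive integers $d,n_1,\ldots,n_d$. Let $\mathcal{K}_+=\mathbb{R}^{n_1}_+\times\cdots\times\mathbb{R}^{n_d}_+$ (nonnegative entries), $\mathcal{K}_{++}=\mathbb{R}^{n_1}_{++}\times\cdots\times\mathbb{R}^{n_d}_{++}$ (positive entries), $\mathcal{I}=\bigcup_{k=1}^d(\{k\}\times[n_k])$. Write $\mathbf{x}=(\mathbf{x}_1,\ldots,\mathbf{x}_d)$, $\mathbf{x}_i=(x_{i,1},\ldots,x_{i,n_i})$, and $F_{i,j_i}$ for the components of $F$. $\mathbf{x}\le\mathbf{y}$ means $\mathbf{y}-\mathbf{x}\in\mathcal{K}_+$. For $\boldsymbol{\alpha}\in\mathbb{R}^d$, $\boldsymbol{\alpha}\otimes\mathbf{x}=(\alpha_1\mathbf{x}_1,\ldots,\alpha_d\mathbf{x}_d)$. For $\boldsymbol{\alpha}\in\mathbb{R}^d_{++}$ and $B\in\mathbb{R}^{d\times d}$, $\boldsymbol{\alpha}^B=(\prod_{k}\alpha_k^{B_{1,k}},\ldots,\prod_k\alpha_k^{B_{d,k}})$. $\mathbf{1}$ is the vector of all ones. For $\boldsymbol{\phi}\in\mathcal{K}_{++}$, $\mathcal{S}^{\boldsymbol{\phi}}_{++}=\{\mathbf{x}\in\mathcal{K}_{++}:\langle\mathbf{x}_i,\boldsymbol{\phi}_i\rangle=1\ \forall i\in[d]\}$. A nonnegative matrix $M\in\mathbb{R}^{n\times n}$ is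 irreducible if $(I+M)^{n-1}$ has positive entries. $F\colon\mathcal{K}_+\to\mathcal{K}_+$ is order-preserving if $\mathbf{x}\le\mathbf{y}$ implies $F(\mathbf{x})\le F(\mathbf{y})$; it is multi-homogeneous with homogeneity matrix $\mathcal{A}(F)=A\in\mathbb{R}^{d\times d}$ if $F(\boldsymbol{\alpha}\otimes\mathbf{x})=\boldsymbol{\alpha}^A\otimes F(\mathbf{x})$ for all $\mathbf{x}\in\mathcal{K}_+$, $\boldsymbol{\alpha}\in\mathbb{R}^d_{++}$. $\mathcal{H}^d$ is the set of $F\colon\mathcal{K}_+\to\mathcal{K}_+$ that are continuous, order-preserving and multi-homogeneous, with $F(\mathbf{1})\in\mathcal{K}_{++}$ and such that $\mathcal{A}(F)$ has at least one nonzero entry per row. (For such $F$ the matrix $\mathcal{A}(F)$ is nonnegative.) An eigenvector of $F$ is $\mathbf{x}$ with $\mathbf{x}_i\neq0$ for all $i$ and $F(\mathbf{x})=\boldsymbol{\theta}\otimes\mathbf{x}$ for some $\boldsymbol{\theta}\in\mathbb{R}^d$. *)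

theory Defs
  imports "HOL-Analysis.Analysis"
begin

text \<open>
  The product \<open>\<real>\<^sup>n\<^sup>1 \<times> \<dots> \<times> \<real>\<^sup>n\<^sup>d\<close> is \<open>real ^ 'm\<close>: the type \<open>'m\<close> plays the role of the index set
  \<open>\<I> = \<Union>\<^sub>k {k} \<times> [n\<^sub>k]\<close>, the type \<open>'d\<close> that of \<open>[d]\<close>, and \<open>blk :: 'm \<Rightarrow> 'd\<close> is the first projection
  \<open>(k, j) \<mapsto> k\<close>.  Thus \<open>n\<^sub>k\<close> is the cardinality of the fibre \<open>blk -` {k}\<close>, and \<open>surj blk\<close> says that
  every \<open>n\<^sub>k\<close> is positive.  The order \<open>\<le>\<close> on \<open>real ^ 'm\<close> is the componentwise one.
\<close>

definition nonneg_cone :: "(real ^ 'm) set" where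
  "nonneg_cone = {x. \<forall>p. 0 \<le> x $ p}"

definition pos_cone :: "(real ^ 'm) set" where
  "pos_cone = {x. \<forall>p. 0 < x $ p}"

definition block_scale :: "('m::finite \<Rightarrow> 'd::finite) \<Rightarrow> real ^ 'd \<Rightarrow> real ^ 'm \<Rightarrow> real ^ 'm" where
  "block_scale blk \<alpha> x = (\<chi> p. \<alpha> $ blk p * x $ p)"

text \<open>The vector \<open>\<alpha>\<^sup>B\<close>, meant for positive \<open>\<alpha>\<close>.\<close>

definition vec_powr :: "real ^ 'd \<Rightarrow> real ^ 'd ^ 'd \<Rightarrow> real ^ 'd" where
  "vec_powr \<alpha> B = (\<chi> i. \<Prod>k\<in>UNIV. \<alpha> $ k powr B $ i $ k)"

definition normalized_pos_cone :: "('m::finite \<Rightarrow> 'd::finite) \<Rightarrow> real ^ 'm \<Rightarrow> (real ^ 'm) set" where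
  "normalized_pos_cone blk \<phi> =
    {x \<in> pos_cone. \<forall>i. (\<Sum>p | blk p = i. x $ p * \<phi> $ p) = 1}"

text \<open>
  Maps \<open>\<K>\<^sub>+ \<rightarrow> \<K>\<^sub>+\<close> are total functions on \<open>real ^ 'm\<close>; their values outside
  \<open>nonneg_cone\<close> are irrelevant (differentiability and partial derivatives are only considered at
  interior points).
\<close>

definition multi_homogeneous ::
    "('m::finite \<Rightarrow> 'd::finite) \<Rightarrow> (real ^ 'm \<Rightarrow> real ^ 'm) \<Rightarrow> real ^ 'd ^ 'd \<Rightarrow> bool" where
  "multi_homogeneous blk F A \<longleftrightarrow>
    (\<forall>x\<in>nonneg_cone. \<forall>\<alpha>\<in>pos_cone.
      F (block_scale blk \<alpha> x) = block_scale blk (vec_powr \<alpha> A) (F x))"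

text \<open>
  The class \<open>\<H>\<^sup>d\<close>.  When \<open>blk\<close> is surjective, positivity of \<open>F(1)\<close> determines the homogeneity
  matrix uniquely.
\<close>

definition hom_class :: "('m::finite \<Rightarrow> 'd::finite) \<Rightarrow> (real ^ 'm \<Rightarrow> real ^ 'm) set" where
  "hom_class blk = {F. F \<in> nonneg_cone \<rightarrow> nonneg_cone \<and> continuous_on nonneg_cone F \<and>
     mono_on nonneg_cone F \<and> F (\<chi> p. 1) \<in> pos_cone \<and>
     (\<exists>A. multi_homogeneous blk F A \<and> (\<forall>i. \<exists>k. A $ i $ k \<noteq> 0))}"

definition eigenvector ::
    "('m::finite \<Rightarrow> 'd::finite) \<Rightarrow> (real ^ 'm \<Rightarrow> real ^ 'm) \<Rightarrow> real ^ 'm \<Rightarrow> bool" where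
  "eigenvector blk F x \<longleftrightarrow> x \<in> nonneg_cone \<and> (\<forall>i. \<exists>p. blk p = i \<and> x $ p \<noteq> 0) \<and>
     (\<exists>\<theta>. F x = block_scale blk \<theta> x)"

text \<open>
  The notion is only meant for matrices with nonnegative entries.  The powers are those of the matrix
  product \<open>**\<close>; the overloaded \<open>^\<close> on \<open>real ^ 'n ^ 'n\<close> is entrywise.
\<close>

definition irreducible_matrix :: "real ^ 'n ^ 'n \<Rightarrow> bool" where
  "irreducible_matrix M \<longleftrightarrow>
    (\<forall>i j. 0 < (((**) (mat 1 + M) ^^ (CARD('n) - 1)) (mat 1)) $ i $ j)"

definition complex_spectrum :: "real ^ 'n ^ 'n \<Rightarrow> complex set" where
  "complex_spectrum M =
    {z. \<exists>v :: complex ^ 'n. v \<noteq> 0 \<and> (\<chi> i j. complex_of_real (M $ i $ j)) *v v = z *s v}"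

definition spectral_radius :: "real ^ 'n ^ 'n \<Rightarrow> real" where
  "spectral_radius M = (SUP z\<in>complex_spectrum M. cmod z)"

definition partial_deriv :: "'m::finite \<Rightarrow> (real ^ 'm \<Rightarrow> real) \<Rightarrow> real ^ 'm \<Rightarrow> real" where
  "partial_deriv q f x = deriv (\<lambda>t. f (x + t *\<^sub>R axis q 1)) 0"

end

theory Submission
  imports Defs
begin

text \<open>
  Dividing \<open>F\<close> blockwise by \<open>\<lambda>\<close> gives an order-preserving map \<open>G\<close> with the same homogeneity matrix
  \<open>A\<close>, with \<open>G(u) = u\<close>, and whose Jacobian at \<open>u\<close> is \<open>L\<close>.  Since \<open>A\<close> is nonnegative, irreducible and
  of spectral radius \<open>1\<close>, it has positive right and left fixed vectors: \<open>A c = c\<close> and \<open>A\<^sup>T b = b\<close>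
  (\<open>perron_vectors_spectral_radius_one\<close>; the vectors come from Brouwer's theorem).

  The vector \<open>c\<close> makes the curve \<open>t \<mapsto> t\<^sup>c \<otimes> u\<close> consist of fixed points of \<open>G\<close>.  Its velocity at
  \<open>t = 1\<close> is \<open>c \<otimes> u\<close>, so \<open>L (c \<otimes> u) = c \<otimes> u\<close>
  (\<open>derivative_at_fixed_point_fixes_scaling_direction\<close>).  As \<open>L\<close> is nonnegative and \<open>c \<otimes> u\<close> is
  positive, \<open>\<rho>(L) = 1\<close> (\<open>spectral_radius_eqI_pos_eigenvector\<close>).

  The vector \<open>b\<close> serves to compare \<open>u\<close> with another positive eigenvector \<open>v\<close>.  Let \<open>m\<close> be the largest
  vector with \<open>m \<otimes> u \<le> v\<close>.  Monotonicity bounds the eigenvalues of \<open>v\<close> from below through \<open>m\<close>, and in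
  the same way from above; summing the logarithms with the weights \<open>b\<close> forces equality in every
  block, which says that \<open>w = m\<^sup>-\<^sup>1 \<otimes> v\<close> is a fixed point of \<open>G\<close> with \<open>u \<le> w\<close>, equal to \<open>u\<close> in some
  coordinate \<open>p\<close> (\<open>eigenvector_rescales_to_touching_fixed_point\<close>).  By the normalization it
  suffices to show \<open>w = u\<close>.

  If \<open>w \<noteq> u\<close>, then for \<open>t > 1\<close> close to \<open>1\<close> the order interval between \<open>u\<close> and the meet of
  \<open>w\<close> and \<open>t\<^sup>c \<otimes> u\<close> contains a fixed point of \<open>G\<close> other than \<open>u\<close>, by the Knaster-Tarski argument
  (\<open>fixed_points_near_touching_fixed_point\<close>).  These fixed points tend to \<open>u\<close> as \<open>t \<rightarrow> 1\<close> and agree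
  with \<open>u\<close> in coordinate \<open>p\<close>.  A limit of the directions in which they approach \<open>u\<close> is a nonzero
  fixed vector of \<open>L\<close> that vanishes at \<open>p\<close>
  (\<open>fixed_points_accumulating_imp_derivative_fixed_vector\<close>), so it is not a multiple of the positive
  fixed vector \<open>c \<otimes> u\<close>, and \<open>ker (I - L)\<close> has dimension at least two.
\<close>

section \<open>Block scalings and the positive cone\<close>

lemma block_scale_nth [simp]: "block_scale blk \<alpha> x $ p = \<alpha> $ blk p * x $ p"
  by (simp add: block_scale_def)

lemma pos_cone_subset_nonneg_cone: "pos_cone \<subseteq> nonneg_cone"
  by (auto simp: pos_cone_def nonneg_cone_def less_imp_le)

lemma pos_cone_upward_closed: "u \<in> pos_cone \<Longrightarrow> u \<le> x \<Longrightarrow> x \<in> pos_cone"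
  by (auto simp: pos_cone_def less_eq_vec_def intro: less_le_trans)

lemma block_scale_pos_cone:
  "\<alpha> \<in> pos_cone \<Longrightarrow> x \<in> pos_cone \<Longrightarrow> block_scale blk \<alpha> x \<in> pos_cone"
  by (auto simp: pos_cone_def)

lemma vec_powr_pos_cone: "\<alpha> \<in> pos_cone \<Longrightarrow> vec_powr \<alpha> A \<in> pos_cone"
  by (auto simp: pos_cone_def vec_powr_def intro!: prod_pos) (metis less_irrefl)

lemma ln_vec_powr:
  assumes "\<alpha> \<in> pos_cone"
  shows "ln (vec_powr \<alpha> A $ i) = (\<Sum>k\<in>UNIV. A $ i $ k * ln (\<alpha> $ k))"
proof -
  have pos: "0 < \<alpha> $ k" for k
    using assms by (simp add: pos_cone_def)
  then have "ln (\<Prod>k\<in>UNIV. \<alpha> $ k powr A $ i $ k) = (\<Sum>k\<in>UNIV. ln (\<alpha> $ k powr A $ i $ k))"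
    by (subst ln_prod) (auto simp: less_imp_neq[symmetric])
  with pos show ?thesis
    by (simp add: vec_powr_def ln_powr less_imp_neq[symmetric])
qed

text \<open>
  Hence a map of homogeneity matrix \<open>A\<close> commutes with the block scalings by \<open>t\<^sup>c\<close>.
\<close>

lemma vec_powr_eigenvector:
  assumes "A *v c = c" and "0 < t"
  shows "vec_powr (\<chi> i. t powr c $ i) A = (\<chi> i. t powr c $ i)"
proof (rule vec_eq_iff[THEN iffD2], rule allI)
  fix i
  have "vec_powr (\<chi> i. t powr c $ i) A $ i = t powr (A *v c) $ i"
    using assms(2)
    by (simp add: vec_powr_def powr_powr matrix_vector_mult_def powr_sum mult.commute)
  then show "vec_powr (\<chi> i. t powr c $ i) A $ i = (\<chi> i. t powr c $ i) $ i"
    using assms(1) by simp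
qed

text \<open>
  Doubling one block of the all-ones vector cannot decrease its image, but multiplies block \<open>i\<close> of
  the image by \<open>2\<close> to the power of an entry of \<open>A\<close>.
\<close>

lemma homogeneity_matrix_nonneg:
  fixes blk :: "'m::finite \<Rightarrow> 'd::finite"
  assumes surj: "surj blk" and mono: "mono_on nonneg_cone F"
    and one: "F (\<chi> p. 1) \<in> pos_cone" and hom: "multi_homogeneous blk F A"
  shows "0 \<le> A $ i $ k"
proof -
  define \<alpha> :: "real ^ 'd" where "\<alpha> = (\<chi> j. if j = k then 2 else 1)"
  let ?e = "(\<chi> p. 1) :: real ^ 'm"
  have \<alpha>: "\<alpha> \<in> pos_cone"
    by (simp add: \<alpha>_def pos_cone_def)
  obtain p where p: "blk p = i"
    using surj by (metis surjD)
  have "?e \<in> nonneg_cone" "block_scale blk \<alpha> ?e \<in> nonneg_cone" "?e \<le> block_scale blk \<alpha> ?e"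
    by (auto simp: nonneg_cone_def \<alpha>_def less_eq_vec_def)
  then have "F ?e \<le> F (block_scale blk \<alpha> ?e)"
    using mono by (auto simp: mono_on_def)
  also have "\<dots> = block_scale blk (vec_powr \<alpha> A) (F ?e)"
    using hom \<alpha> \<open>?e \<in> nonneg_cone\<close> by (simp add: multi_homogeneous_def)
  finally have "F ?e $ p \<le> vec_powr \<alpha> A $ i * F ?e $ p"
    using p by (auto simp: less_eq_vec_def dest: spec[of _ p])
  moreover have "0 < F ?e $ p"
    using one by (simp add: pos_cone_def)
  moreover have "vec_powr \<alpha> A $ i = 2 powr (A $ i $ k)"
  proof -
    have "\<alpha> $ j powr A $ i $ j = (if j = k then 2 powr (A $ i $ k) else 1)" for j
      by (simp add: \<alpha>_def)
    then show ?thesis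
      by (simp add: vec_powr_def)
  qed
  ultimately have "2 powr 0 \<le> 2 powr (A $ i $ k)"
    by simp
  then show ?thesis
    by (subst (asm) powr_le_cancel_iff) auto
qed

section \<open>Perron vectors\<close>

text \<open>
  The weighted maximum of \<open>|v\<^sub>i| / w\<^sub>i\<close> over the coordinates of a complex eigenvector \<open>v\<close> is
  attained somewhere; the eigenvalue equation at that coordinate bounds the eigenvalue by \<open>r\<close>.
  Since \<open>r\<close> is itself an eigenvalue, the bound is attained.
\<close>

lemma spectral_radius_eqI_pos_eigenvector:
  fixes M :: "real ^ 'n ^ 'n"
  assumes nonneg: "\<And>i j. 0 \<le> M $ i $ j" and w: "w \<in> pos_cone" and eig: "M *v w = r *s w"
  shows "spectral_radius M = r"
proof -
  let ?C = "\<chi> i j. complex_of_real (M $ i $ j)"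
  have wpos: "0 < w $ i" for i
    using w by (simp add: pos_cone_def)
  have row: "(\<Sum>j\<in>UNIV. M $ i $ j * w $ j) = r * w $ i" for i
    using arg_cong[OF eig, of "\<lambda>x. x $ i"] by (simp add: matrix_vector_mult_def)
  have "0 \<le> r * w $ undefined"
    unfolding row[symmetric] by (intro sum_nonneg mult_nonneg_nonneg nonneg less_imp_le wpos)
  then have r: "0 \<le> r"
    using wpos by (simp add: zero_le_mult_iff) (meson not_le)
  have upper: "cmod z \<le> r" if "z \<in> complex_spectrum M" for z
  proof -
    obtain v where "v \<noteq> 0" and v: "?C *v v = z *s v"
      using \<open>z \<in> complex_spectrum M\<close> by (auto simp: complex_spectrum_def)
    define s where "s = Max (range (\<lambda>i. cmod (v $ i) / w $ i))"
    have "s \<in> range (\<lambda>i. cmod (v $ i) / w $ i)"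
      unfolding s_def by (rule Max_in) auto
    then obtain i where "s = cmod (v $ i) / w $ i" by auto
    then have i: "cmod (v $ i) = s * w $ i"
      using wpos[of i] by simp
    have le: "cmod (v $ j) \<le> s * w $ j" for j
    proof -
      have "cmod (v $ j) / w $ j \<le> s" unfolding s_def by (rule Max_ge) auto
      then show ?thesis using wpos[of j] by (simp add: divide_le_eq)
    qed
    obtain j where "v $ j \<noteq> 0" using \<open>v \<noteq> 0\<close> by (auto simp: vec_eq_iff)
    then have "0 < s * w $ j" using le[of j] by (meson less_le_trans zero_less_norm_iff)
    then have "0 < s" using wpos[of j] by (simp add: zero_less_mult_iff)
    have "z * v $ i = (\<Sum>j\<in>UNIV. complex_of_real (M $ i $ j) * v $ j)"
      using arg_cong[OF v, of "\<lambda>x. x $ i"] by (simp add: matrix_vector_mult_def)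
    then have "cmod z * cmod (v $ i) \<le> (\<Sum>j\<in>UNIV. cmod (complex_of_real (M $ i $ j) * v $ j))"
      by (metis norm_mult norm_sum)
    also have "\<dots> \<le> (\<Sum>j\<in>UNIV. M $ i $ j * (s * w $ j))"
      by (intro sum_mono) (simp add: norm_mult nonneg mult_left_mono le)
    also have "\<dots> = s * (\<Sum>j\<in>UNIV. M $ i $ j * w $ j)"
      by (simp add: sum_distrib_left algebra_simps)
    also have "\<dots> = r * cmod (v $ i)"
      by (simp add: row i)
    finally show ?thesis
      using \<open>0 < s\<close> wpos[of i] by (simp add: i)
  qed
  define wc where "wc = (\<chi> i. complex_of_real (w $ i))"
  have "wc $ undefined \<noteq> 0"
    using wpos[of undefined] by (simp add: wc_def)
  then have "wc \<noteq> 0" by force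
  moreover have "?C *v wc = complex_of_real r *s wc"
    by (simp add: vec_eq_iff matrix_vector_mult_def wc_def row
        flip: of_real_mult of_real_sum)
  ultimately have "complex_of_real r \<in> complex_spectrum M"
    unfolding complex_spectrum_def by blast
  then have "cmod (complex_of_real r) \<in> cmod ` complex_spectrum M"
    by (rule imageI)
  then have "r \<in> cmod ` complex_spectrum M"
    using r by simp
  then show ?thesis
    unfolding spectral_radius_def by (rule cSup_eq_maximum) (auto intro: upper)
qed

text \<open>
  A fixed point of \<open>x \<mapsto> (x + M x) / (1 + \<Sigma>\<^sub>i (M x)\<^sub>i)\<close> on the standard simplex is an eigenvector.
  Adding \<open>x\<close> to \<open>M x\<close> keeps the map defined where \<open>M x = 0\<close>.
\<close>

lemma nonneg_matrix_nonneg_eigenvector: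
  fixes M :: "real ^ 'n ^ 'n"
  assumes nonneg: "\<And>i j. 0 \<le> M $ i $ j"
  obtains x r where "x \<in> nonneg_cone" "x \<noteq> 0" "0 \<le> r" "M *v x = r *s x"
proof -
  let ?\<sigma> = "\<lambda>x :: real ^ 'n. \<Sum>i\<in>UNIV. x $ i"
  define S :: "(real ^ 'n) set" where "S = {x. (\<forall>i. 0 \<le> x $ i) \<and> ?\<sigma> x = 1}"
  define f where "f x = (1 / (1 + ?\<sigma> (M *v x))) *\<^sub>R (x + M *v x)" for x
  have Mx: "0 \<le> (M *v x) $ i" if "x \<in> S" for x i
    using that nonneg by (auto simp: S_def matrix_vector_mult_def intro!: sum_nonneg)
  then have \<sigma>: "0 \<le> ?\<sigma> (M *v x)" if "x \<in> S" for x
    using that by (simp add: sum_nonneg)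
  have "norm x \<le> 1" if "x \<in> S" for x
    using norm_le_l1_cart[of x] that by (simp add: S_def)
  then have "bounded S"
    by (auto simp: bounded_iff)
  moreover have "closed S"
    unfolding S_def by (intro closed_Collect_conj closed_Collect_all closed_Collect_le
        closed_Collect_eq continuous_intros)
  ultimately have "compact S"
    by (simp add: compact_eq_bounded_closed)
  moreover have "convex S"
    by (auto simp: convex_def S_def sum.distrib simp flip: sum_distrib_left)
  moreover have "S \<noteq> {}"
  proof -
    have "axis undefined 1 \<in> S"
      by (auto simp: S_def axis_def)
    then show ?thesis by blast
  qed
  moreover have "continuous_on S f"
    unfolding f_def using \<sigma> by (intro continuous_intros) (auto, smt (verit))
  moreover have "f \<in> S \<rightarrow> S"
  proof
    fix x assume x: "x \<in> S"
    have "0 \<le> f x $ i" for i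
      using x \<sigma>[OF x] Mx[OF x, of i] by (simp add: f_def S_def)
    moreover have "?\<sigma> (f x) = 1"
    proof -
      have "?\<sigma> (f x) = (?\<sigma> x + ?\<sigma> (M *v x)) / (1 + ?\<sigma> (M *v x))"
        by (simp add: f_def sum.distrib flip: sum_divide_distrib)
      then show ?thesis using x \<sigma>[OF x] by (simp add: S_def)
    qed
    ultimately show "f x \<in> S" by (simp add: S_def)
  qed
  ultimately obtain x where x: "x \<in> S" and "f x = x"
    using brouwer by metis
  let ?r = "?\<sigma> (M *v x)"
  have "(1 + ?r) *\<^sub>R f x = x + M *v x"
    using \<sigma>[OF x] by (simp add: f_def)
  then have "M *v x = ?r *s x"
    using \<open>f x = x\<close> by (simp add: algebra_simps scalar_mult_eq_scaleR)
  moreover have "x \<in> nonneg_cone" "x \<noteq> 0"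
    using x by (auto simp: S_def nonneg_cone_def)
  ultimately show thesis
    using that \<sigma>[OF x] by blast
qed

lemma matrix_funpow_eigenvector:
  fixes B :: "real ^ 'n ^ 'n"
  assumes "B *v x = s *s x"
  shows "(((**) B ^^ k) (mat 1)) *v x = s ^ k *s x"
  by (induction k) (simp_all add: assms matrix_vector_mul_assoc[symmetric] vector_scalar_commute
      ac_simps)

lemma transpose_matrix_funpow:
  fixes B :: "real ^ 'n ^ 'n"
  shows "transpose (((**) B ^^ k) (mat 1)) = ((**) (transpose B) ^^ k) (mat 1)"
proof -
  have comm: "((**) C ^^ k) (mat 1) ** C = C ** ((**) C ^^ k) (mat 1)" for C :: "real ^ 'n ^ 'n" and k
    by (induction k) (simp_all add: matrix_mul_assoc[symmetric])
  show ?thesis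
    by (induction k) (simp_all add: transpose_mat matrix_transpose_mul comm)
qed

lemma irreducible_matrix_transpose:
  assumes "irreducible_matrix M"
  shows "irreducible_matrix (transpose M)"
proof -
  have "mat 1 + transpose M = transpose (mat 1 + M)"
    by (simp add: vec_eq_iff transpose_def mat_def)
  then show ?thesis
    using assms by (simp add: irreducible_matrix_def flip: transpose_matrix_funpow)
      (simp add: transpose_def)
qed

text \<open>
  The positive matrix \<open>(I + M)\<^sup>n\<^sup>-\<^sup>1\<close> maps a nonnegative eigenvector of \<open>M\<close> to a positive vector, which
  is a multiple of it.
\<close>

lemma irreducible_matrix_pos_eigenvector:
  fixes M :: "real ^ 'n ^ 'n"
  assumes nonneg: "\<And>i j. 0 \<le> M $ i $ j" and irr: "irreducible_matrix M"
  obtains x r where "x \<in> pos_cone" "M *v x = r *s x"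
proof -
  obtain x r where x: "x \<in> nonneg_cone" "x \<noteq> 0" and r: "0 \<le> r" "M *v x = r *s x"
    using nonneg_matrix_nonneg_eigenvector[OF nonneg] by metis
  let ?P = "((**) (mat 1 + M) ^^ (CARD('n) - 1)) (mat 1)"
  have "(mat 1 + M) *v x = (1 + r) *s x"
    using r(2) by (simp add: matrix_vector_mult_add_rdistrib vector_sadd_rdistrib)
  then have P: "?P *v x = (1 + r) ^ (CARD('n) - 1) *s x"
    by (rule matrix_funpow_eigenvector)
  have "0 < x $ i" for i
  proof -
    obtain j where j: "0 < x $ j"
      using x by (auto simp: nonneg_cone_def vec_eq_iff order.order_iff_strict)
    have "0 < (\<Sum>j\<in>UNIV. ?P $ i $ j * x $ j)"
      using irr x(1) j
      by (intro sum_pos2[of _ j]) (auto simp: irreducible_matrix_def nonneg_cone_def less_imp_le)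
    also have "\<dots> = (1 + r) ^ (CARD('n) - 1) * x $ i"
      using arg_cong[OF P, of "\<lambda>y. y $ i"] by (simp add: matrix_vector_mult_def)
    finally show ?thesis
      using r(1) by (simp add: zero_less_mult_iff)
  qed
  then show thesis
    using that r(2) by (auto simp: pos_cone_def)
qed

text \<open>
  The eigenvalue of the positive right eigenvector is the spectral radius.  That of the left one is
  the same because \<open>b \<bullet> c > 0\<close>.
\<close>

lemma perron_vectors_spectral_radius_one:
  fixes A :: "real ^ 'n ^ 'n"
  assumes nonneg: "\<And>i j. 0 \<le> A $ i $ j" and irr: "irreducible_matrix A"
    and rho: "spectral_radius A = 1"
  obtains b c where "b \<in> pos_cone" "transpose A *v b = b" "c \<in> pos_cone" "A *v c = c"
proof -
  obtain c r where c: "c \<in> pos_cone" "A *v c = r *s c"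
    using irreducible_matrix_pos_eigenvector[OF nonneg irr] by metis
  then have Ac: "A *v c = c"
    using spectral_radius_eqI_pos_eigenvector[OF nonneg c] rho by simp
  have "0 \<le> transpose A $ i $ j" for i j
    using nonneg by (simp add: transpose_def)
  then obtain b s where b: "b \<in> pos_cone" "transpose A *v b = s *s b"
    using irreducible_matrix_pos_eigenvector[OF _ irreducible_matrix_transpose[OF irr]] by metis
  have "0 < b \<bullet> c"
    using b(1) c(1) by (auto simp: inner_vec_def pos_cone_def intro!: sum_pos)
  moreover have "(transpose A *v b) \<bullet> c = b \<bullet> (A *v c)"
    by (simp add: dot_lmul_matrix)
  then have "s * (b \<bullet> c) = b \<bullet> c"
    by (simp add: b(2) Ac scalar_mult_eq_scaleR del: transpose_matrix_vector)
  ultimately have "s = 1" by simp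
  then show thesis
    using that b c(1) Ac by simp
qed

section \<open>Comparison of two eigenvectors\<close>

lemma touching_block_scale:
  fixes blk :: "'m::finite \<Rightarrow> 'd::finite"
  assumes surj: "surj blk" and u: "u \<in> pos_cone" and v: "v \<in> pos_cone"
  obtains m where "m \<in> pos_cone" "block_scale blk m u \<le> v"
    "\<forall>i. \<exists>p. blk p = i \<and> m $ i * u $ p = v $ p"
proof -
  define R where "R i = (\<lambda>p. v $ p / u $ p) ` {p. blk p = i}" for i
  define m where "m = (\<chi> i. Min (R i))"
  have pos: "0 < u $ p" "0 < v $ p" for p
    using u v by (auto simp: pos_cone_def)
  have touch: "\<exists>p. blk p = i \<and> m $ i * u $ p = v $ p" for i
  proof -
    have "R i \<noteq> {}"
      using surj by (auto simp: R_def surj_def) metis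
    then have "Min (R i) \<in> R i"
      by (intro Min_in) (auto simp: R_def)
    then obtain p where "blk p = i" "m $ i = v $ p / u $ p"
      by (auto simp: R_def m_def)
    then show ?thesis
      using pos(1)[of p] by auto
  qed
  moreover have "m \<in> pos_cone"
  proof -
    have "0 < m $ i" for i
      using touch[of i] pos by (metis zero_less_mult_pos2)
    then show ?thesis by (simp add: pos_cone_def)
  qed
  moreover have "block_scale blk m u \<le> v"
  proof -
    have "m $ blk p \<le> v $ p / u $ p" for p
      by (auto simp: m_def R_def)
    then show ?thesis
      using pos(1) by (simp add: less_eq_vec_def le_divide_eq)
  qed
  ultimately show thesis
    using that by blast
qed

text \<open>
  Applying \<open>G\<close> to \<open>m \<otimes> u \<le> v\<close> and reading off a coordinate of block \<open>i\<close> where equality holds gives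
  \<open>(m\<^sup>A)\<^sub>i \<le> \<theta>\<^sub>i m\<^sub>i\<close>; likewise \<open>l \<otimes> v \<le> u\<close> gives \<open>(l\<^sup>A)\<^sub>i \<theta>\<^sub>i \<le> l\<^sub>i\<close>.  Because \<open>A\<^sup>T b = b\<close>, the sums of
  \<open>ln (m\<^sup>A)\<close> and \<open>ln m\<close> with the weights \<open>b\<close> coincide, and so do those for \<open>l\<close>.  Hence the weighted
  sum of \<open>ln \<theta>\<close> is both nonnegative and nonpositive, so equality holds throughout:
  \<open>m\<^sup>A = \<theta> m\<close>, which is precisely the condition for \<open>m\<^sup>-\<^sup>1 \<otimes> v\<close> to be fixed.
\<close>

lemma eigenvector_rescales_to_touching_fixed_point:
  fixes blk :: "'m::finite \<Rightarrow> 'd::finite" and G :: "real ^ 'm \<Rightarrow> real ^ 'm"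
  assumes surj: "surj blk" and mono: "mono_on nonneg_cone G"
    and hom: "multi_homogeneous blk G A"
    and b: "b \<in> pos_cone" "transpose A *v b = b"
    and u: "u \<in> pos_cone" "G u = u"
    and v: "v \<in> pos_cone" "G v = block_scale blk \<theta> v"
  obtains m w where "v = block_scale blk m w" "G w = w" "u \<le> w" "\<exists>p. w $ p = u $ p"
proof -
  obtain m where m: "m \<in> pos_cone" "block_scale blk m u \<le> v"
    and m_touch: "\<forall>i. \<exists>p. blk p = i \<and> m $ i * u $ p = v $ p"
    by (rule touching_block_scale[OF surj u(1) v(1)])
  obtain l where l: "l \<in> pos_cone" "block_scale blk l v \<le> u"
    and l_touch: "\<forall>i. \<exists>p. blk p = i \<and> l $ i * v $ p = u $ p"
    by (rule touching_block_scale[OF surj v(1) u(1)])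
  have pos: "0 < u $ p" "0 < v $ p" "0 < m $ i" "0 < l $ i"
    "0 < vec_powr m A $ i" "0 < vec_powr l A $ i" for p i
    using u(1) v(1) m(1) l(1) vec_powr_pos_cone[OF m(1), of A] vec_powr_pos_cone[OF l(1), of A]
    by (auto simp: pos_cone_def)
  note sub = pos_cone_subset_nonneg_cone[THEN subsetD]
  have "G (block_scale blk m u) \<le> G v"
    using mono m u(1) v(1) by (auto simp: mono_on_def intro: sub block_scale_pos_cone)
  then have mG: "block_scale blk (vec_powr m A) u \<le> block_scale blk \<theta> v"
    using hom m(1) u v(2) sub[OF u(1)] by (simp add: multi_homogeneous_def)
  have "G (block_scale blk l v) \<le> G u"
    using mono l u(1) v(1) by (auto simp: mono_on_def intro: sub block_scale_pos_cone)
  then have lG: "block_scale blk (vec_powr l A) (block_scale blk \<theta> v) \<le> u"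
    using hom l(1) u v(2) sub[OF v(1)] by (simp add: multi_homogeneous_def)
  have m_le: "vec_powr m A $ i \<le> \<theta> $ i * m $ i" for i
  proof -
    obtain p where p: "blk p = i" "m $ i * u $ p = v $ p"
      using m_touch by blast
    have "vec_powr m A $ i * u $ p \<le> \<theta> $ i * (m $ i * u $ p)"
      using mG p by (auto simp: less_eq_vec_def dest: spec[of _ p])
    then show ?thesis
      using pos(1)[of p] by (simp add: mult.assoc[symmetric])
  qed
  have l_le: "vec_powr l A $ i * \<theta> $ i \<le> l $ i" for i
  proof -
    obtain p where p: "blk p = i" "l $ i * v $ p = u $ p"
      using l_touch by blast
    have "vec_powr l A $ i * \<theta> $ i * v $ p \<le> l $ i * v $ p"
      using lG p by (auto simp: less_eq_vec_def mult.assoc dest: spec[of _ p])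
    then show ?thesis
      using pos(2)[of p] by simp
  qed
  have \<theta>: "0 < \<theta> $ i" for i
    using m_le[of i] pos(3,5)[of i] by (metis less_le_trans zero_less_mult_pos2)
  have weighted: "(\<Sum>i\<in>UNIV. b $ i * (\<Sum>k\<in>UNIV. A $ i $ k * \<mu> k)) = (\<Sum>k\<in>UNIV. b $ k * \<mu> k)"
    for \<mu> :: "'d \<Rightarrow> real"
  proof -
    have "(\<Sum>i\<in>UNIV. b $ i * (\<Sum>k\<in>UNIV. A $ i $ k * \<mu> k))
      = (\<Sum>k\<in>UNIV. (\<Sum>i\<in>UNIV. A $ i $ k * b $ i) * \<mu> k)"
      by (simp add: sum_distrib_left sum_distrib_right mult_ac) (rule sum.swap)
    also have "\<dots> = (\<Sum>k\<in>UNIV. (transpose A *v b) $ k * \<mu> k)"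
      by (simp only: matrix_vector_mult_def transpose_def vec_lambda_beta)
    finally show ?thesis
      by (simp only: b(2))
  qed
  \<comment> \<open>The slack in the lower bound for \<open>\<theta>\<^sub>i\<close>, on the logarithmic scale.\<close>
  define g where "g i = ln (\<theta> $ i) + ln (m $ i) - ln (vec_powr m A $ i)" for i
  have "0 \<le> g i" for i
  proof -
    have "ln (vec_powr m A $ i) \<le> ln (\<theta> $ i * m $ i)"
      using m_le pos(5) by (simp add: ln_mono)
    then show ?thesis
      using \<theta>[of i] pos(3)[of i] by (simp add: g_def ln_mult)
  qed
  then have bg: "0 \<le> b $ i * g i" for i
    using b(1) by (simp add: pos_cone_def less_imp_le)
  have sum_g: "(\<Sum>i\<in>UNIV. b $ i * g i) = (\<Sum>i\<in>UNIV. b $ i * ln (\<theta> $ i))"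
    using weighted[of "\<lambda>k. ln (m $ k)"]
    by (simp add: g_def ln_vec_powr[OF m(1)] ring_distribs sum.distrib sum_subtractf)
  also have "\<dots> \<le> (\<Sum>i\<in>UNIV. b $ i * (ln (l $ i) - ln (vec_powr l A $ i)))"
  proof (intro sum_mono mult_left_mono)
    fix i
    have "ln (vec_powr l A $ i * \<theta> $ i) \<le> ln (l $ i)"
      using l_le \<theta> pos(6) by (simp add: ln_mono)
    then show "ln (\<theta> $ i) \<le> ln (l $ i) - ln (vec_powr l A $ i)"
      using \<theta>[of i] pos(6)[of i] by (simp add: ln_mult)
  qed (use b(1) in \<open>simp add: pos_cone_def less_imp_le\<close>)
  also have "\<dots> = 0"
    using weighted[of "\<lambda>k. ln (l $ k)"]
    by (simp add: ln_vec_powr[OF l(1)] right_diff_distrib sum_subtractf)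
  finally have "(\<Sum>i\<in>UNIV. b $ i * g i) = 0"
    using sum_nonneg[of UNIV "\<lambda>i. b $ i * g i"] bg by simp
  then have "b $ i * g i = 0" for i
    using bg by (subst (asm) sum_nonneg_eq_0_iff) auto
  then have g0: "g i = 0" for i
    using b(1) by (metis less_irrefl mem_Collect_eq mult_eq_0_iff pos_cone_def)
  have m_eq: "vec_powr m A $ i = \<theta> $ i * m $ i" for i
  proof -
    have "ln (vec_powr m A $ i) = ln (\<theta> $ i * m $ i)"
      using g0[of i] \<theta>[of i] pos(3)[of i] by (simp add: g_def ln_mult)
    then show ?thesis
      using \<theta>[of i] pos(3,5)[of i] by simp
  qed
  define w where "w = block_scale blk (\<chi> i. 1 / m $ i) v"
  have vw: "v = block_scale blk m w"
    using pos(3) by (simp add: vec_eq_iff w_def less_imp_neq[symmetric])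
  have w: "w \<in> pos_cone"
    using pos by (simp add: w_def pos_cone_def)
  have "block_scale blk \<theta> v = block_scale blk (vec_powr m A) (G w)"
    using hom sub[OF w] m(1) v(2) vw by (simp add: multi_homogeneous_def)
  moreover have "v $ p = m $ blk p * w $ p" for p
    by (subst vw) simp
  ultimately have "\<theta> $ blk p * (m $ blk p * w $ p) = \<theta> $ blk p * m $ blk p * G w $ p" for p
    by (simp add: vec_eq_iff m_eq)
  then have "G w = w"
    using \<theta> pos(3) by (simp add: vec_eq_iff less_imp_neq[symmetric])
  moreover have "u \<le> w"
  proof -
    have "m $ blk p * u $ p \<le> m $ blk p * w $ p" for p
      using m(2) by (subst (asm) vw) (simp add: less_eq_vec_def)
    then show ?thesis
      using pos(3) by (simp add: less_eq_vec_def)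
  qed
  moreover have "\<exists>p. w $ p = u $ p"
  proof -
    obtain p where "m $ blk p * u $ p = v $ p"
      using m_touch by metis
    then have "m $ blk p * u $ p = m $ blk p * w $ p"
      by (subst (asm) vw) simp
    then have "w $ p = u $ p"
      using pos(3)[of "blk p"] by simp
    then show ?thesis ..
  qed
  ultimately show thesis
    using that vw by blast
qed

section \<open>Fixed points near a fixed point\<close>

text \<open>
  Let \<open>T\<close> be the least number with \<open>w \<le> T\<^sup>c \<otimes> u\<close>.  Both \<open>u\<close> and \<open>(t/T)\<^sup>c \<otimes> w\<close> are fixed, hence \<open>G\<close>
  does not decrease their join \<open>x\<close>; and \<open>w\<close> and \<open>t\<^sup>c \<otimes> u\<close> are fixed upper bounds of \<open>x\<close>.  So there
  is a fixed point between \<open>x\<close> and these bounds.  It differs from \<open>u\<close> because, in a coordinate where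
  \<open>w\<close> equals \<open>T\<^sup>c \<otimes> u\<close>, already \<open>x\<close> equals \<open>t\<^sup>c \<otimes> u\<close>.
\<close>

lemma fixed_points_near_touching_fixed_point:
  fixes blk :: "'m::finite \<Rightarrow> 'd::finite" and G :: "real ^ 'm \<Rightarrow> real ^ 'm"
  assumes mono: "mono_on nonneg_cone G" and hom: "multi_homogeneous blk G A"
    and c: "c \<in> pos_cone" "A *v c = c"
    and u: "u \<in> pos_cone" "G u = u"
    and w: "G w = w" "u \<le> w" "w \<noteq> u"
  obtains T where "1 < T"
    "\<And>t. 1 < t \<Longrightarrow> t \<le> T \<Longrightarrow>
      \<exists>y. G y = y \<and> y \<noteq> u \<and> u \<le> y \<and> y \<le> w \<and> y \<le> block_scale blk (\<chi> i. t powr c $ i) u"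
proof -
  let ?sc = "\<lambda>t. block_scale blk (\<chi> i. t powr c $ i)"
  have wpos: "w \<in> pos_cone"
    using u(1) w(2) by (rule pos_cone_upward_closed)
  have pos: "0 < u $ p" "0 < w $ p" "0 < c $ i" for p i
    using u(1) wpos c(1) by (auto simp: pos_cone_def)
  have G_mono: "G x \<le> G y" if "x \<in> pos_cone" "x \<le> y" for x y
    using mono pos_cone_subset_nonneg_cone pos_cone_upward_closed[OF that] that
    by (auto simp: mono_on_def)
  have G_scale: "G (?sc t x) = ?sc t x" if "0 < t" "x \<in> pos_cone" "G x = x" for t x
    using hom that vec_powr_eigenvector[OF c(2) that(1)] pos_cone_subset_nonneg_cone
    by (auto simp: multi_homogeneous_def pos_cone_def nonneg_cone_def less_imp_le)
  \<comment> \<open>The solution of \<open>w\<^sub>p = t\<^sup>c u\<^sub>p\<close> for \<open>t\<close>, maximized over all coordinates \<open>p\<close>.\<close>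
  define T where "T = Max (range (\<lambda>p. (w $ p / u $ p) powr (1 / c $ blk p)))"
  have T_powr: "((w $ p / u $ p) powr (1 / c $ blk p)) powr c $ blk p = w $ p / u $ p" for p
    using pos(1,2)[of p] pos(3)[of "blk p"] by (simp add: powr_powr)
  have T_ge: "(w $ p / u $ p) powr (1 / c $ blk p) \<le> T" for p
    unfolding T_def by (rule Max_ge) auto
  have w_le: "w $ p \<le> T powr c $ blk p * u $ p" for p
  proof -
    have "((w $ p / u $ p) powr (1 / c $ blk p)) powr c $ blk p \<le> T powr c $ blk p"
      using T_ge[of p] pos(3)[of "blk p"] by (intro powr_mono2) auto
    then have "w $ p / u $ p \<le> T powr c $ blk p"
      by (simp only: T_powr)
    then show ?thesis
      using pos(1)[of p] by (simp add: divide_le_eq)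
  qed
  have "T \<in> range (\<lambda>p. (w $ p / u $ p) powr (1 / c $ blk p))"
    unfolding T_def by (rule Max_in) auto
  then obtain p where p: "T powr c $ blk p = w $ p / u $ p"
    using T_powr by auto
  obtain q where q: "u $ q < w $ q"
    using w(2,3) unfolding less_eq_vec_def vec_eq_iff by (metis order.not_eq_order_implies_strict)
  have "1 < (w $ q / u $ q) powr (1 / c $ blk q)"
    using q pos(1)[of q] pos(3)[of "blk q"] by (intro gr_one_powr) auto
  then have T1: "1 < T"
    using T_ge[of q] by linarith
  have "\<exists>y. G y = y \<and> y \<noteq> u \<and> u \<le> y \<and> y \<le> w \<and> y \<le> ?sc t u" if t: "1 < t" "t \<le> T" for t
  proof -
    define s where "s = t / T"
    have s: "0 < s" "s \<le> 1"
      using t T1 by (auto simp: s_def)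
    \<comment> \<open>The Knaster-Tarski set of subsolutions; its supremum is the fixed point.\<close>
    define S where "S = {y. u \<le> y \<and> y \<le> w \<and> y \<le> ?sc t u \<and> y \<le> G y}"
    define x where "x = sup u (?sc s w)"
    define y where "y = Sup S"
    have st: "s powr c $ blk p * (T powr c $ blk p * u $ p) = t powr c $ blk p * u $ p" for p
      using t T1 by (simp add: s_def powr_divide)
    have sw: "?sc s w \<le> w"
    proof -
      have "s powr c $ blk p * w $ p \<le> 1 * w $ p" for p
        using s pos(2)[of p] pos(3)[of "blk p"] by (intro mult_right_mono powr_le1) auto
      then show ?thesis
        by (simp add: less_eq_vec_def)
    qed
    have uT: "u \<le> ?sc t u"
    proof -
      have "1 * u $ p \<le> t powr c $ blk p * u $ p" for p
        using t pos(1)[of p] pos(3)[of "blk p"]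
        by (intro mult_right_mono ge_one_powr_ge_zero) auto
      then show ?thesis
        by (simp add: less_eq_vec_def)
    qed
    have "?sc s w \<le> ?sc t u"
    proof -
      have "s powr c $ blk p * w $ p \<le> t powr c $ blk p * u $ p" for p
        using mult_left_mono[OF w_le[of p], of "s powr c $ blk p"] st[of p] by simp
      then show ?thesis
        by (simp add: less_eq_vec_def)
    qed
    moreover have "?sc s w \<in> pos_cone"
      using s wpos by (auto simp: pos_cone_def)
    then have "?sc s w \<le> G x"
      using G_mono[of "?sc s w" x] G_scale[OF s(1) wpos w(1)] by (simp add: x_def)
    moreover have "u \<le> G x"
      using G_mono[OF u(1), of x] u(2) by (simp add: x_def)
    ultimately have x: "x \<in> S"
      using w(2) sw uT by (simp add: S_def x_def)
    have bdd: "bdd_above S"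
      by (auto simp: S_def bdd_above_def)
    have xy: "x \<le> y"
      unfolding y_def using x bdd by (rule cSup_upper)
    have uy: "u \<le> y"
      using xy by (simp add: x_def)
    then have ypos: "y \<in> pos_cone"
      using u(1) pos_cone_upward_closed by blast
    have yw: "y \<le> w"
      unfolding y_def using x by (intro cSup_least) (auto simp: S_def)
    have yt: "y \<le> ?sc t u"
      unfolding y_def using x by (intro cSup_least) (auto simp: S_def)
    have yG: "y \<le> G y"
    proof -
      have "z \<le> G y" if "z \<in> S" for z
      proof -
        have "z \<le> y"
          unfolding y_def using that bdd by (rule cSup_upper)
        moreover have "z \<in> pos_cone" "z \<le> G z"
          using that u(1) pos_cone_upward_closed by (auto simp: S_def)
        ultimately show ?thesis
          using G_mono by (meson order_trans)
      qed
      then show ?thesis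
        using x cSup_least[of S "G y"] by (auto simp: y_def)
    qed
    have "G y \<in> S"
      using G_mono[OF ypos yw] G_mono[OF ypos yt] G_mono[OF u(1) uy] G_mono[OF ypos yG]
        G_scale[OF _ u, of t] t u(2) w(1) by (simp add: S_def)
    then have "G y \<le> y"
      using cSup_upper[OF _ bdd, of "G y"] by (simp add: y_def)
    then have "G y = y"
      using yG by simp
    moreover have "y \<noteq> u"
    proof
      assume "y = u"
      then have "?sc s w \<le> u"
        using xy by (simp add: x_def)
      then have "s powr c $ blk p * (T powr c $ blk p * u $ p) \<le> u $ p"
        using p pos(1)[of p] by (simp add: less_eq_vec_def)
      then have "t powr c $ blk p * u $ p \<le> u $ p"
        by (simp only: st)
      then have "t powr c $ blk p \<le> 1"
        using pos(1)[of p] by simp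
      moreover have "1 < t powr c $ blk p"
        using t pos(3)[of "blk p"] by (intro gr_one_powr)
      ultimately show False by simp
    qed
    ultimately show ?thesis
      using uy yw yt by blast
  qed
  with T1 show thesis
    using that by blast
qed

text \<open>
  The unit vectors \<open>h\<close> from \<open>u\<close> towards the fixed points satisfy \<open>h - D h \<rightarrow> 0\<close>, since
  \<open>G (y\<^sub>n) - G u = y\<^sub>n - u\<close>; any limit point of them is fixed by \<open>D\<close>.  The vector \<open>e\<close> records a
  linear constraint that survives the limit.
\<close>

lemma fixed_points_accumulating_imp_derivative_fixed_vector:
  fixes G :: "'a::euclidean_space \<Rightarrow> 'a"
  assumes deriv: "(G has_derivative D) (at u)" and u: "G u = u"
    and y: "\<And>n. G (y n) = y n" "\<And>n. y n \<noteq> u" "y \<longlonglongrightarrow> u"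
    and perp: "\<And>n :: nat. (y n - u) \<bullet> e = 0"
  obtains z where "z \<noteq> 0" "D z = z" "z \<bullet> e = 0"
proof -
  interpret D: bounded_linear D
    using deriv by (rule has_derivative_bounded_linear)
  define h where "h n = (y n - u) /\<^sub>R norm (y n - u)" for n
  have "h n \<in> sphere 0 1" for n
    using y(2)[of n] by (simp add: h_def)
  then obtain z r where z: "z \<in> sphere 0 1" and r: "strict_mono (r :: nat \<Rightarrow> nat)"
    and lim: "(h \<circ> r) \<longlonglongrightarrow> z"
    using compact_sphere[of "0 :: 'a" 1] unfolding compact_def by (metis (no_types, lifting))
  have "filterlim y (at u) sequentially"
    using y(2,3) by (simp add: filterlim_at)
  moreover have "((\<lambda>x. (G x - G u - D (x - u)) /\<^sub>R norm (x - u)) \<longlongrightarrow> 0) (at u)"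
    using deriv by (simp add: has_derivative_within inverse_eq_divide diff_diff_eq)
  ultimately have lim0: "(\<lambda>n. (G (y n) - G u - D (y n - u)) /\<^sub>R norm (y n - u)) \<longlonglongrightarrow> 0"
    by (rule filterlim_compose[rotated])
  have "(G (y n) - G u - D (y n - u)) /\<^sub>R norm (y n - u) = h n - D (h n)" for n
    unfolding h_def D.scaleR y(1) u by (simp only: scaleR_diff_right)
  with lim0 have "(\<lambda>n. h n - D (h n)) \<longlonglongrightarrow> 0"
    by simp
  then have "((\<lambda>n. h n - D (h n)) \<circ> r) \<longlonglongrightarrow> 0"
    using r by (rule LIMSEQ_subseq_LIMSEQ)
  moreover have "((\<lambda>n. h n - D (h n)) \<circ> r) \<longlonglongrightarrow> z - D z"
    using tendsto_diff[OF lim D.tendsto[OF lim]] by (simp add: o_def)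
  ultimately have "D z = z"
    using LIMSEQ_unique by fastforce
  moreover have "z \<bullet> e = 0"
  proof -
    have "(\<lambda>n. (h \<circ> r) n \<bullet> e) \<longlonglongrightarrow> z \<bullet> e"
      using lim by (rule tendsto_inner) (rule tendsto_const)
    moreover have "(h \<circ> r) n \<bullet> e = 0" for n
      by (simp add: h_def perp)
    ultimately show ?thesis
      by (simp add: LIMSEQ_const_iff)
  qed
  moreover have "z \<noteq> 0"
    using z by auto
  ultimately show thesis
    using that by blast
qed

section \<open>The derivative of an order-preserving multi-homogeneous map\<close>

lemma partial_deriv_eq_derivative_axis:
  fixes F :: "real ^ 'm \<Rightarrow> real ^ 'n"
  assumes "(F has_derivative D) (at u)"
  shows "((\<lambda>t. F (u + t *\<^sub>R axis q 1) $ p) has_real_derivative D (axis q 1) $ p) (at 0)"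
    and "partial_deriv q (\<lambda>x. F x $ p) u = D (axis q 1) $ p"
proof -
  interpret D: bounded_linear D
    using assms by (rule has_derivative_bounded_linear)
  have line: "((\<lambda>t. u + t *\<^sub>R axis q 1) has_derivative (\<lambda>t. t *\<^sub>R axis q 1)) (at 0)"
    by (auto intro!: derivative_eq_intros)
  have "((\<lambda>t. F (u + t *\<^sub>R axis q 1)) has_derivative (\<lambda>t. D (t *\<^sub>R axis q 1))) (at 0)"
    using diff_chain_at[OF line, of F D] assms by (simp add: o_def)
  then have "((\<lambda>t. F (u + t *\<^sub>R axis q 1) $ p) has_derivative (\<lambda>t. D (t *\<^sub>R axis q 1) $ p)) (at 0)"
    by (rule bounded_linear.has_derivative[OF bounded_linear_vec_nth])
  then show "((\<lambda>t. F (u + t *\<^sub>R axis q 1) $ p) has_real_derivative D (axis q 1) $ p) (at 0)"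
    by (simp add: has_field_derivative_def D.scaleR mult_commute_abs)
  then show "partial_deriv q (\<lambda>x. F x $ p) u = D (axis q 1) $ p"
    unfolding partial_deriv_def by (rule DERIV_imp_deriv)
qed

lemma derivative_of_mono_nonneg:
  fixes F :: "real ^ 'm \<Rightarrow> real ^ 'n"
  assumes deriv: "(F has_derivative D) (at u)" and mono: "mono_on nonneg_cone F"
    and u: "u \<in> nonneg_cone"
  shows "0 \<le> D (axis q 1) $ p"
proof -
  let ?f = "\<lambda>t. F (u + t *\<^sub>R axis q 1) $ p"
  have "((\<lambda>t. (?f t - ?f 0) / (t - 0)) \<longlongrightarrow> D (axis q 1) $ p) (at_right 0)"
    using partial_deriv_eq_derivative_axis(1)[OF deriv]
    by (auto simp: has_field_derivative_iff intro: filterlim_mono at_le)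
  moreover have "\<forall>\<^sub>F t in at_right 0. 0 \<le> (?f t - ?f 0) / (t - 0)"
  proof (rule eventually_at_right_less[THEN eventually_mono])
    fix t :: real assume "0 < t"
    then have "u + t *\<^sub>R axis q 1 \<in> nonneg_cone" "u \<le> u + t *\<^sub>R axis q 1"
      using u by (auto simp: nonneg_cone_def less_eq_vec_def axis_def)
    then have "F u \<le> F (u + t *\<^sub>R axis q 1)"
      using mono u by (auto simp: mono_on_def)
    with \<open>0 < t\<close> show "0 \<le> (?f t - ?f 0) / (t - 0)"
      by (simp add: less_eq_vec_def)
  qed
  ultimately show ?thesis
    by (rule tendsto_lowerbound) simp
qed

text \<open>
  The curve \<open>t \<mapsto> t\<^sup>c \<otimes> u\<close> passes through \<open>u\<close> at \<open>t = 1\<close> and is fixed pointwise by \<open>G\<close>, so \<open>D\<close> fixes its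
  velocity there.
\<close>

lemma derivative_at_fixed_point_fixes_scaling_direction:
  fixes blk :: "'m::finite \<Rightarrow> 'd::finite" and G :: "real ^ 'm \<Rightarrow> real ^ 'm"
  assumes hom: "multi_homogeneous blk G A" and c: "A *v c = c"
    and u: "u \<in> nonneg_cone" "G u = u" and deriv: "(G has_derivative D) (at u)"
  shows "D (block_scale blk c u) = block_scale blk c u"
proof -
  define \<gamma> where "\<gamma> t = block_scale blk (\<chi> i. t powr c $ i) u" for t
  have \<gamma>_nth: "((\<lambda>t. \<gamma> t $ p) has_real_derivative block_scale blk c u $ p) (at 1)" for p
    unfolding \<gamma>_def by (auto intro!: derivative_eq_intros)
  have \<gamma>: "(\<gamma> has_vector_derivative block_scale blk c u) (at 1)"
    unfolding has_vector_derivative_def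
  proof (rule has_derivative_componentwise_within[THEN iffD2], rule ballI)
    fix i :: "real ^ 'm" assume "i \<in> Basis"
    then obtain p where i: "i = axis p 1"
      by (auto simp: Basis_vec_def)
    show "((\<lambda>t. \<gamma> t \<bullet> i) has_derivative (\<lambda>t. (t *\<^sub>R block_scale blk c u) \<bullet> i)) (at 1)"
      using has_field_derivative_imp_has_derivative[OF \<gamma>_nth[of p]]
      by (simp add: i inner_axis mult_commute_abs)
  qed
  have "\<gamma> 1 = u"
    by (simp add: \<gamma>_def vec_eq_iff)
  then have "((G \<circ> \<gamma>) has_vector_derivative D (block_scale blk c u)) (at 1)"
    using vector_derivative_diff_chain_within[of \<gamma> "block_scale blk c u" 1 UNIV G D] \<gamma> deriv
    by (simp add: has_derivative_at_withinI)
  moreover have "(G \<circ> \<gamma>) t = \<gamma> t" if "0 < t" for t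
    using hom u vec_powr_eigenvector[OF c that] that
    by (simp add: \<gamma>_def multi_homogeneous_def pos_cone_def)
  then have "((G \<circ> \<gamma>) has_vector_derivative block_scale blk c u) (at 1)"
    using has_vector_derivative_transform_within_open[OF \<gamma>, of "{0<..}" "G \<circ> \<gamma>"] by simp
  ultimately show ?thesis
    by (rule vector_derivative_unique_at)
qed

section \<open>Uniqueness of the normalized eigenvector\<close>

lemma dim_1_collinear:
  fixes V :: "'a::euclidean_space set"
  assumes "dim V = 1" and "w \<in> V" "z \<in> V" "w \<noteq> 0"
  obtains k where "z = k *\<^sub>R w"
proof -
  have "z \<in> span {w}"
  proof (rule ccontr)
    assume z: "z \<notin> span {w}"
    then have "independent {z, w}"
      using assms(4) by (simp add: independent_insert)
    moreover have "z \<noteq> w"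
      using z span_base[of w "{w}"] by auto
    ultimately show False
      using independent_card_le_dim[of "{z, w}" V] assms by simp
  qed
  then show thesis
    using that by (auto simp: span_singleton)
qed

text \<open>
  Otherwise the fixed points near \<open>u\<close>, squeezed between \<open>u\<close> and \<open>w\<close>, all agree with \<open>u\<close> in
  coordinate \<open>p\<close>.  They produce a nonzero fixed vector of \<open>D\<close> vanishing at \<open>p\<close>, which is not
  collinear with the positive fixed vector \<open>c \<otimes> u\<close>.
\<close>

lemma fixed_point_unique_if_derivative_fixed_space_1_dim:
  fixes blk :: "'m::finite \<Rightarrow> 'd::finite" and G :: "real ^ 'm \<Rightarrow> real ^ 'm"
  assumes mono: "mono_on nonneg_cone G" and hom: "multi_homogeneous blk G A"
    and c: "c \<in> pos_cone" "A *v c = c"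
    and u: "u \<in> pos_cone" "G u = u"
    and deriv: "(G has_derivative D) (at u)" and dim: "dim {v. D v = v} = 1"
    and w: "G w = w" "u \<le> w" and touch: "w $ p = u $ p"
  shows "w = u"
proof (rule ccontr)
  assume "w \<noteq> u"
  let ?sc = "\<lambda>t. block_scale blk (\<chi> i. t powr c $ i)"
  obtain T where T: "1 < T" and near: "\<And>t. 1 < t \<Longrightarrow> t \<le> T \<Longrightarrow>
      \<exists>y. G y = y \<and> y \<noteq> u \<and> u \<le> y \<and> y \<le> w \<and> y \<le> ?sc t u"
    by (rule fixed_points_near_touching_fixed_point[OF mono hom c u w \<open>w \<noteq> u\<close>]) blast
  \<comment> \<open>A sequence in the interval from \<open>1\<close> (excluded) to \<open>T\<close> that tends to \<open>1\<close>.\<close>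
  define t where "t n = 1 + (T - 1) / real (Suc n)" for n
  have t: "1 < t n" "t n \<le> T" for n
    using T divide_left_mono[of 1 "real (Suc n)" "T - 1"] by (auto simp: t_def)
  have t_lim: "t \<longlonglongrightarrow> 1"
    unfolding t_def using tendsto_add[OF tendsto_const LIMSEQ_Suc[OF lim_const_over_n]]
    by fastforce
  obtain y where y: "\<And>n. G (y n) = y n" "\<And>n. y n \<noteq> u" "\<And>n. u \<le> y n" "\<And>n. y n \<le> w"
    "\<And>n. y n \<le> ?sc (t n) u"
    using near[OF t] by metis
  have "y \<longlonglongrightarrow> u"
  proof (rule vec_tendstoI)
    fix q
    have "(\<lambda>n. t n powr c $ blk q * u $ q) \<longlonglongrightarrow> 1 powr c $ blk q * u $ q"
      by (intro tendsto_intros t_lim) simp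
    then have upper: "(\<lambda>n. t n powr c $ blk q * u $ q) \<longlonglongrightarrow> u $ q"
      by simp
    have "u $ q \<le> y n $ q" "y n $ q \<le> t n powr c $ blk q * u $ q" for n
      using y(3,5)[of n] by (simp_all add: less_eq_vec_def)
    then show "(\<lambda>n. y n $ q) \<longlonglongrightarrow> u $ q"
      by (intro tendsto_sandwich[OF _ _ tendsto_const upper] always_eventually allI)
  qed
  moreover have "(y n - u) \<bullet> axis p 1 = 0" for n
  proof -
    have "u $ p \<le> y n $ p" "y n $ p \<le> w $ p"
      using y(3)[of n] y(4)[of n] by (simp_all add: less_eq_vec_def)
    with touch show ?thesis
      by (simp add: inner_axis)
  qed
  ultimately obtain z where z: "z \<noteq> 0" "D z = z" "z \<bullet> axis p 1 = 0"
    by (rule fixed_points_accumulating_imp_derivative_fixed_vector[OF deriv u(2) y(1,2)])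
  have cu: "block_scale blk c u \<in> pos_cone"
    using c(1) u(1) by (rule block_scale_pos_cone)
  then have "block_scale blk c u \<noteq> 0"
    by (force simp: pos_cone_def)
  moreover have "D (block_scale blk c u) = block_scale blk c u"
    using derivative_at_fixed_point_fixes_scaling_direction[OF hom c(2) _ u(2) deriv]
      subsetD[OF pos_cone_subset_nonneg_cone u(1)] by simp
  ultimately obtain k where k: "z = k *\<^sub>R block_scale blk c u"
    using dim_1_collinear[OF dim, of "block_scale blk c u" z] z(2) by auto
  have "0 < block_scale blk c u $ p"
    using cu unfolding pos_cone_def by blast
  moreover have "k * block_scale blk c u $ p = 0"
    using z(3) by (simp add: k inner_axis)
  ultimately have "k = 0"
    by (metis less_irrefl mult_eq_0_iff)
  with k z(1) show False by simp
qed

lemma normalized_pos_cone_block_scale_eq: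
  assumes u: "u \<in> normalized_pos_cone blk \<phi>"
    and v: "block_scale blk m u \<in> normalized_pos_cone blk \<phi>"
  shows "block_scale blk m u = u"
proof -
  have "m $ i = 1" for i
  proof -
    have "1 = (\<Sum>p | blk p = i. m $ i * (u $ p * \<phi> $ p))"
      using v by (auto simp: normalized_pos_cone_def mult.assoc)
    also have "\<dots> = m $ i"
      using u by (simp add: normalized_pos_cone_def flip: sum_distrib_left)
    finally show ?thesis by simp
  qed
  then show ?thesis
    by (simp add: vec_eq_iff)
qed

theorem theorem4p4:
  fixes blk :: "'m::finite \<Rightarrow> 'd::finite"
    and \<phi> u :: "real ^ 'm"
    and F :: "real ^ 'm \<Rightarrow> real ^ 'm"
    and A :: "real ^ 'd ^ 'd"
    and lam :: "real ^ 'd"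
    and L :: "real ^ 'm ^ 'm"
  assumes "surj blk"
    and "\<phi> \<in> pos_cone"
    and "F \<in> hom_class blk"
    and "multi_homogeneous blk F A"
    and "irreducible_matrix A"
    and "spectral_radius A = 1"
    and "lam \<in> pos_cone"
    and "u \<in> normalized_pos_cone blk \<phi>"
    and "F u = block_scale blk lam u"
    and "F differentiable (at u)"
    and "L = (\<chi> p q. 1 / lam $ blk p * partial_deriv q (\<lambda>x. F x $ p) u)"
  shows "spectral_radius L = 1 \<and>
    (dim {v. (mat 1 - L) *v v = 0} = 1 \<longrightarrow>
      {x \<in> normalized_pos_cone blk \<phi>. eigenvector blk F x} = {u})"
proof -
  have F_mono: "mono_on nonneg_cone F" and one: "F (\<chi> p. 1) \<in> pos_cone"
    using assms(3) by (auto simp: hom_class_def)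
  have lam: "0 < lam $ i" for i
    using assms(7) by (simp add: pos_cone_def)
  have u: "u \<in> pos_cone" "u \<in> nonneg_cone"
    using assms(8) pos_cone_subset_nonneg_cone by (auto simp: normalized_pos_cone_def)
  obtain b c where b: "b \<in> pos_cone" "transpose A *v b = b"
    and c: "c \<in> pos_cone" "A *v c = c"
    by (rule perron_vectors_spectral_radius_one[OF
          homogeneity_matrix_nonneg[OF assms(1) F_mono one assms(4)] assms(5,6)])
  let ?N = "block_scale blk (\<chi> i. 1 / lam $ i) :: real ^ 'm \<Rightarrow> real ^ 'm"
  define G where "G x = ?N (F x)" for x
  have G_mono: "mono_on nonneg_cone G"
    using F_mono lam
    by (auto simp: mono_on_def G_def less_eq_vec_def less_imp_le intro!: divide_right_mono)
  have G_hom: "multi_homogeneous blk G A"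
    using assms(4) by (simp add: multi_homogeneous_def G_def vec_eq_iff)
  have Gu: "G u = u"
    using lam by (simp add: G_def assms(9) vec_eq_iff less_imp_neq[symmetric])
  obtain D where D: "(F has_derivative D) (at u)"
    using assms(10) by (auto simp: differentiable_def)
  have "linear ?N"
    by (rule linearI) (simp_all add: vec_eq_iff algebra_simps add_divide_distrib)
  then have "bounded_linear ?N"
    by (simp only: linear_conv_bounded_linear)
  then have "(G has_derivative (\<lambda>h. ?N (D h))) (at u)"
    unfolding G_def using D by (rule bounded_linear.has_derivative)
  moreover have L_axis: "L = matrix (\<lambda>h. ?N (D h))"
    by (simp add: assms(11) matrix_def vec_eq_iff partial_deriv_eq_derivative_axis(2)[OF D])
  ultimately have deriv: "(G has_derivative (*v) L) (at u)"
    by (simp add: L_axis matrix_works has_derivative_linear)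
  have "0 \<le> L $ p $ q" for p q
    using derivative_of_mono_nonneg[OF deriv G_mono u(2), of q p]
    by (simp add: matrix_vector_mul_component inner_axis)
  moreover have "L *v block_scale blk c u = block_scale blk c u"
    by (rule derivative_at_fixed_point_fixes_scaling_direction[OF G_hom c(2) u(2) Gu deriv])
  ultimately have "spectral_radius L = 1"
    using block_scale_pos_cone[OF c(1) u(1)] by (intro spectral_radius_eqI_pos_eigenvector) auto
  moreover have "{x \<in> normalized_pos_cone blk \<phi>. eigenvector blk F x} = {u}"
    if "dim {v. (mat 1 - L) *v v = 0} = 1"
  proof -
    have "{v. (mat 1 - L) *v v = 0} = {v. L *v v = v}"
      by (auto simp: matrix_vector_mult_diff_rdistrib)
    then have dim: "dim {v. L *v v = v} = 1"
      using that by simp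
    have "x = u" if x: "x \<in> normalized_pos_cone blk \<phi>" and "eigenvector blk F x" for x
    proof -
      obtain \<theta> where "F x = block_scale blk \<theta> x"
        using \<open>eigenvector blk F x\<close> by (auto simp: eigenvector_def)
      then have Gx: "G x = block_scale blk (\<chi> i. \<theta> $ i / lam $ i) x"
        by (simp add: G_def vec_eq_iff)
      have xpos: "x \<in> pos_cone"
        using x by (simp add: normalized_pos_cone_def)
      obtain m w where xw: "x = block_scale blk m w"
        and w: "G w = w" "u \<le> w" and "\<exists>p. w $ p = u $ p"
        by (rule eigenvector_rescales_to_touching_fixed_point[OF
              assms(1) G_mono G_hom b u(1) Gu xpos Gx])
      then obtain p where "w $ p = u $ p"
        by blast
      with w have "w = u"
        by (rule fixed_point_unique_if_derivative_fixed_space_1_dim[OF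
              G_mono G_hom c u(1) Gu deriv dim])
      then show "x = u"
        using normalized_pos_cone_block_scale_eq[OF assms(8), of m] x xw by simp
    qed
    moreover have "eigenvector blk F u"
    proof -
      have "u $ p \<noteq> 0" for p
        using u(1) by (simp add: pos_cone_def less_imp_neq[symmetric])
      then have "\<exists>p. blk p = i \<and> u $ p \<noteq> 0" for i
        using surjD[OF assms(1), of i] by auto
      then show ?thesis
        using u(2) assms(9) by (auto simp: eigenvector_def)
    qed
    ultimately show ?thesis
      using assms(8) by blast
  qed
  ultimately show ?thesis
    by blast
qed

end
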